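(* Let $(T_i)_{i=1}^{\infty}$ be a sequence of bounded linear operators from a separable Banach space $X$ to a normed linear space $Y$. Then the following assertions are equivalent: (1) $(T_i)_i$ is densely mean Li-Yorke $\delta$-chaotic for some $\delta>0$; (2) $(T_i)_i$ is densely mean Li-Yorke extremely chaotic; (3) $(T_i)_i$ has a dense set (in $X\times X$) of mean Li-Yorke extreme pairs; (4) $(T_i)_i$ has a residual set (in $X\times X$) of mean Li-Yorke extreme pairs; (5) $(T_i)_i$ has a dense set (in $X$) of absolutely mean irregular vectors; (6) $(T_i)_i$ has a residual set (in $X$) of absolutely mean irregular vectors; (7) the mean proximal relation of $(T_i)_i$ is dense in $X\times X$ and $(T_i)_i$ is mean sensitive.
   Context: Let $(T_i)_{i=1}^\infty$ be a sequence of bounded linear operators from a normed linear space $X$ to a normed linear space $Y$. A pair $(x,y)\in X\times X$ is \emph{mean proximal} if $\liminf_{n\to\infty}\frac1n\sum_{i=1}^n\Vert T_ix-T_iy\Vert=0$; the \emph{mean proximal relation} is the set of all mean proximal pairs. For $\delta>0$, a \emph{mean Li-Yorke $\delta$ pair} is a mean proximal pair $(x,y)$ with $\limsup_{n\to\infty}\frac1n\sum_{i=1}^n\Vert T_ix-T_iy\Vert\ge\delta$; a \emph{mean Li-Yorke extreme pair} is a mean proximal pair $(x,y)$ with $\limsup_{n\to\infty}\frac1n\sum_{i=1}^n\Vert T_ix-T_iy\Vert=\infty$. A subset $K\subset X$ is \emph{mean Li-Yorke $\delta$-scrambled} (resp. \emph{extremely scrambled}) if any two distinct points of $K$ form a mean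 Li-Yorke $\delta$ pair (resp. extreme pair). $(T_i)_i$ is \emph{densely mean Li-Yorke $\delta$-chaotic} (resp. \emph{densely mean Li-Yorke extremely chaotic}) if there exists a dense uncountable mean Li-Yorke $\delta$-scrambled (resp. extremely scrambled) subset of $X$. A vector $x\in X$ is \emph{absolutely mean irregular} if $\liminf_{n\to\infty}\frac1n\sum_{i=1}^n\Vert T_ix\Vert=0$ and $\limsup_{n\to\infty}\frac1n\sum_{i=1}^n\Vert T_ix\Vert=\infty$. $(T_i)_i$ is \emph{mean sensitive} if there is $\delta>0$ such that for every $x\in X$ and $\varepsilon>0$ there exists $y\in X$ with $\Vert x-y\Vert<\varepsilon$ and $\limsup_{n\to\infty}\frac{1}{n}\sum_{i=1}^{n}\Vert T_ix-T_iy\Vert>\delta$. A set is residual if it contains a dense $G_\delta$ set. *)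

theory Defs
  imports "HOL-Analysis.Analysis"
begin

text \<open>
  A sequence of operators indexed from 1 is a function on \<^typ>\<open>nat\<close> whose value at 0 is never
  used. Limits inferior and superior are taken in \<^typ>\<open>ereal\<close>, so that they always exist and may
  be infinite.
\<close>

definition mean_norm :: "(nat \<Rightarrow> 'b::real_normed_vector) \<Rightarrow> nat \<Rightarrow> ereal" where
  "mean_norm u n = ereal (1 / real n * (\<Sum>i=1..n. norm (u i)))"

definition mean_proximal :: "(nat \<Rightarrow> 'a \<Rightarrow> 'b::real_normed_vector) \<Rightarrow> 'a \<Rightarrow> 'a \<Rightarrow> bool" where
  "mean_proximal T x y \<longleftrightarrow> liminf (mean_norm (\<lambda>i. T i x - T i y)) = 0"

definition mean_proximal_relation :: "(nat \<Rightarrow> 'a \<Rightarrow> 'b::real_normed_vector) \<Rightarrow> ('a \<times> 'a) set" where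
  "mean_proximal_relation T = {(x, y). mean_proximal T x y}"

definition mean_LY_pair :: "(nat \<Rightarrow> 'a \<Rightarrow> 'b::real_normed_vector) \<Rightarrow> real \<Rightarrow> 'a \<Rightarrow> 'a \<Rightarrow> bool" where
  "mean_LY_pair T \<delta> x y \<longleftrightarrow>
     mean_proximal T x y \<and> limsup (mean_norm (\<lambda>i. T i x - T i y)) \<ge> ereal \<delta>"

definition mean_LY_extreme_pair :: "(nat \<Rightarrow> 'a \<Rightarrow> 'b::real_normed_vector) \<Rightarrow> 'a \<Rightarrow> 'a \<Rightarrow> bool" where
  "mean_LY_extreme_pair T x y \<longleftrightarrow>
     mean_proximal T x y \<and> limsup (mean_norm (\<lambda>i. T i x - T i y)) = \<infinity>"

definition mean_LY_scrambled :: "(nat \<Rightarrow> 'a \<Rightarrow> 'b::real_normed_vector) \<Rightarrow> real \<Rightarrow> 'a set \<Rightarrow> bool" where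
  "mean_LY_scrambled T \<delta> K \<longleftrightarrow> pairwise (mean_LY_pair T \<delta>) K"

definition mean_LY_extremely_scrambled :: "(nat \<Rightarrow> 'a \<Rightarrow> 'b::real_normed_vector) \<Rightarrow> 'a set \<Rightarrow> bool" where
  "mean_LY_extremely_scrambled T K \<longleftrightarrow> pairwise (mean_LY_extreme_pair T) K"

definition dense :: "'a::topological_space set \<Rightarrow> bool" where
  "dense S \<longleftrightarrow> closure S = UNIV"

definition residual :: "'a::topological_space set \<Rightarrow> bool" where
  "residual S \<longleftrightarrow> (\<exists>G. gdelta G \<and> dense G \<and> G \<subseteq> S)"

definition densely_mean_LY_chaotic ::
    "(nat \<Rightarrow> 'a::topological_space \<Rightarrow> 'b::real_normed_vector) \<Rightarrow> real \<Rightarrow> bool" where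
  "densely_mean_LY_chaotic T \<delta> \<longleftrightarrow>
     (\<exists>K. dense K \<and> uncountable K \<and> mean_LY_scrambled T \<delta> K)"

definition densely_mean_LY_extremely_chaotic ::
    "(nat \<Rightarrow> 'a::topological_space \<Rightarrow> 'b::real_normed_vector) \<Rightarrow> bool" where
  "densely_mean_LY_extremely_chaotic T \<longleftrightarrow>
     (\<exists>K. dense K \<and> uncountable K \<and> mean_LY_extremely_scrambled T K)"

definition absolutely_mean_irregular :: "(nat \<Rightarrow> 'a \<Rightarrow> 'b::real_normed_vector) \<Rightarrow> 'a \<Rightarrow> bool" where
  "absolutely_mean_irregular T x \<longleftrightarrow>
     liminf (mean_norm (\<lambda>i. T i x)) = 0 \<and> limsup (mean_norm (\<lambda>i. T i x)) = \<infinity>"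

definition mean_sensitive ::
    "(nat \<Rightarrow> 'a::real_normed_vector \<Rightarrow> 'b::real_normed_vector) \<Rightarrow> bool" where
  "mean_sensitive T \<longleftrightarrow>
     (\<exists>\<delta>>0. \<forall>x. \<forall>\<epsilon>>0. \<exists>y. norm (x - y) < \<epsilon> \<and>
        limsup (mean_norm (\<lambda>i. T i x - T i y)) > ereal \<delta>)"

end

theory Submission
  imports Defs
begin

text \<open>
  The means \<open>x \<mapsto> 1/n * (\<Sum>i=1..n. norm (T i x))\<close> are continuous seminorms, so every pair notion is
  a condition on the difference of the two points. The vectors whose means have lower limit 0, and
  those whose means are unbounded, each form a countable intersection of open sets. Density of the
  former is density of the mean proximal relation. Density of the latter follows from mean
  sensitivity: a small vector with large means perturbs \<open>x\<close> to \<open>x + y\<close> or \<open>x - y\<close> with large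
  means. The Baire category theorem then gives a dense set of absolutely mean irregular vectors.
  For a scrambled set it suffices that countably many translates of this set always have
  dense intersection: this lets one first build a countable dense scrambled set and then shows that
  a maximal scrambled set containing it cannot be countable.
\<close>

section \<open>Dense and residual sets\<close>

lemma dense_iff_meets_open:
  "dense S \<longleftrightarrow> (\<forall>W. open W \<longrightarrow> W \<noteq> {} \<longrightarrow> W \<inter> S \<noteq> {})"
proof
  assume "dense S"
  then show "\<forall>W. open W \<longrightarrow> W \<noteq> {} \<longrightarrow> W \<inter> S \<noteq> {}"
    unfolding dense_def by (metis Int_UNIV_right open_Int_closure_eq_empty)
next
  assume meets: "\<forall>W. open W \<longrightarrow> W \<noteq> {} \<longrightarrow> W \<inter> S \<noteq> {}"
  have "- closure S \<inter> S = {}"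
    using closure_subset by blast
  then have "- closure S = {}"
    using meets by blast
  then show "dense S"
    unfolding dense_def by blast
qed

lemma dense_meets_open:
  assumes "dense S" "open W" "w \<in> W"
  obtains x where "x \<in> S" "x \<in> W"
  using assms unfolding dense_iff_meets_open by blast

lemma dense_mono: "dense S \<Longrightarrow> S \<subseteq> S' \<Longrightarrow> dense S'"
  unfolding dense_def using closure_mono by blast

lemma residual_imp_dense: "residual S \<Longrightarrow> dense S"
  unfolding residual_def using dense_mono by blast

lemma gdelta_dense_imp_residual: "gdelta S \<Longrightarrow> dense S \<Longrightarrow> residual S"
  unfolding residual_def by blast

lemma gdelta_vimage:
  assumes "gdelta S" "continuous_on UNIV f"
  shows "gdelta (f -` S)"
  using assms(1)
proof cases
  case (1 F)
  have "gdelta (\<Inter>n. f -` F n)"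
    using 1(2) assms(2) by (intro gdelta.intros open_vimage)
  then show ?thesis
    using 1(1) by (simp add: vimage_INT)
qed

text \<open>The Baire category theorem: a Banach space is completely metrizable.\<close>

lemma dense_INT_of_open_dense:
  fixes F :: "'i \<Rightarrow> 'a::banach set"
  assumes "countable I" "\<And>i. i \<in> I \<Longrightarrow> open (F i)" "\<And>i. i \<in> I \<Longrightarrow> dense (F i)"
  shows "dense (\<Inter>i\<in>I. F i)"
proof -
  have "euclidean closure_of \<Inter>(F ` I) = topspace euclidean"
    using assms unfolding dense_def
    by (intro Baire_category) (auto simp: completely_metrizable_space_euclidean)
  then show ?thesis
    by (simp add: dense_def)
qed

lemma dense_translation:
  fixes S :: "'a::real_normed_vector set"
  shows "dense S \<Longrightarrow> dense ((+) a ` S)"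
  unfolding dense_def by (simp add: closure_translation)

text \<open>Moves density between the space and its square. Subtraction is continuous and sends
  \<open>(w, 0)\<close> to \<open>w\<close>, so an open set around \<open>w\<close> pulls back to a
  nonempty open set of pairs. Conversely, inside an open box \<open>U \<times> V\<close> around
  \<open>(a, b)\<close> the second coordinate is kept equal to \<open>b\<close>, and the dense
  translate \<open>b + S\<close> meets \<open>U\<close>.\<close>

lemma dense_differences_iff:
  fixes S :: "'a::real_normed_vector set"
  shows "dense ((\<lambda>(x, y). x - y) -` S) \<longleftrightarrow> dense S"
proof
  assume D: "dense ((\<lambda>(x, y). x - y) -` S)"
  show "dense S"
    unfolding dense_iff_meets_open
  proof (intro allI impI)
    fix W :: "'a set" assume "open W" "W \<noteq> {}"
    then obtain w where "w \<in> W" by blast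
    have "open ((\<lambda>(x, y). x - y) -` W)"
      using \<open>open W\<close> by (intro open_vimage) (auto simp: case_prod_unfold intro!: continuous_intros)
    moreover have "(w, 0) \<in> (\<lambda>(x, y). x - y) -` W"
      using \<open>w \<in> W\<close> by simp
    ultimately obtain p where "p \<in> (\<lambda>(x, y). x - y) -` S" "p \<in> (\<lambda>(x, y). x - y) -` W"
      by (rule dense_meets_open[OF D])
    then show "W \<inter> S \<noteq> {}" by auto
  qed
next
  assume D: "dense S"
  show "dense ((\<lambda>(x, y). x - y) -` S)"
    unfolding dense_iff_meets_open
  proof (intro allI impI)
    fix W :: "('a \<times> 'a) set" assume "open W" "W \<noteq> {}"
    then obtain a b where "(a, b) \<in> W" by auto
    then obtain U V where UV: "open U" "open V" "(a, b) \<in> U \<times> V" "U \<times> V \<subseteq> W"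
      using \<open>open W\<close> open_prod_elim by metis
    obtain x where x: "x \<in> (+) b ` S" "x \<in> U"
      using UV dense_meets_open[OF dense_translation[OF D, of b] \<open>open U\<close>] by blast
    then have "(x, b) \<in> W \<inter> (\<lambda>(x, y). x - y) -` S"
      using UV by auto
    then show "W \<inter> (\<lambda>(x, y). x - y) -` S \<noteq> {}" by blast
  qed
qed

text \<open>Writing \<open>I\<close> as the intersection of open sets \<open>F n\<close>, each of
  them dense because it contains \<open>I\<close>, turns the translates into a family of dense open
  sets indexed by the countable set \<open>C \<times> UNIV\<close>, to which Baire applies.\<close>

lemma dense_INT_translations:
  fixes I :: "'a::banach set"
  assumes "gdelta I" "dense I" "countable C"
  shows "dense (\<Inter>c\<in>C. (+) c ` I)"
  using assms(1)
proof cases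
  case (1 F)
  have "dense (\<Inter>p\<in>C \<times> (UNIV :: nat set). (+) (fst p) ` F (snd p))"
  proof (rule dense_INT_of_open_dense)
    have "dense (F n)" for n
      using assms(2) dense_mono 1(1) by blast
    then show "dense ((+) (fst p) ` F (snd p))" for p :: "'a \<times> nat"
      by (rule dense_translation)
  qed (auto intro: open_translation 1(2) assms(3))
  moreover have "x \<in> (+) c ` I"
    if x: "x \<in> (\<Inter>p\<in>C \<times> UNIV. (+) (fst p) ` F (snd p))" and "c \<in> C" for x c
  proof -
    have "x - c \<in> F n" for n
      using x \<open>c \<in> C\<close> by fastforce
    then have "x - c \<in> I"
      unfolding 1(1) by blast
    then show ?thesis
      by (rule rev_image_eqI) simp
  qed
  ultimately show ?thesis
    by (elim dense_mono) blast
qed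

section \<open>Dense uncountable sets with all differences in a dense G_delta set\<close>

lemma separable_space_dense_sequence:
  assumes "separable_space (euclidean :: 'a::topological_space topology)"
  obtains c :: "nat \<Rightarrow> 'a::topological_space" where "dense (range c)"
proof -
  obtain C :: "'a set" where C: "countable C" "closure C = UNIV"
    using assms unfolding separable_space_def by auto
  then have "C \<noteq> {}" by auto
  then have "range (from_nat_into C) = C"
    using C(1) by (rule range_from_nat_into)
  then show ?thesis
    using that C(2) unfolding dense_def by metis
qed

text \<open>A point lying in every translate \<open>a + I\<close>, with \<open>a\<close> in a
  countable set already chosen, can be added to that set; symmetry of \<open>I\<close> covers both
  orders of each new pair. Since \<open>0 \<notin> I\<close>, such a point is always new.\<close>

lemma exists_dense_uncountable_pairwise:
  fixes I :: "'a::banach set"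
  assumes sep: "separable_space (euclidean :: 'a topology)"
    and I: "gdelta I" "dense I" "0 \<notin> I" and sym: "\<And>x. x \<in> I \<Longrightarrow> - x \<in> I"
  shows "\<exists>K. dense K \<and> uncountable K \<and> pairwise (\<lambda>x y. x - y \<in> I) K"
proof -
  obtain c :: "nat \<Rightarrow> 'a" where c: "dense (range c)"
    using sep by (rule separable_space_dense_sequence)
  \<comment> \<open>Every pair of a centre \<open>c i\<close> and a radius
    \<open>1 / (k + 1)\<close> occurs as some \<open>B n\<close>, so picking one point from each
    \<open>B n\<close> already gives a dense set.\<close>
  define B where
    "B n = ball (c (fst (prod_decode n))) (inverse (real (Suc (snd (prod_decode n)))))" for n
  have "\<exists>f. \<forall>n. f n \<in> B n \<and> (\<forall>m<n. f n - f m \<in> I)"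
  proof (rule dependent_wellorder_choice)
    fix n and f :: "nat \<Rightarrow> 'a"
    have "c (fst (prod_decode n)) \<in> B n"
      by (simp add: B_def)
    moreover have "open (B n)" by (simp add: B_def)
    \<comment> \<open>Membership in \<open>f m + I\<close> for all \<open>m < n\<close> says that
      the new point differs from each earlier one by an element of \<open>I\<close>.\<close>
    ultimately obtain x where "x \<in> (\<Inter>a\<in>f ` {..<n}. (+) a ` I)" "x \<in> B n"
      using dense_meets_open dense_INT_translations[OF I(1,2), of "f ` {..<n}"] by blast
    then show "\<exists>r. r \<in> B n \<and> (\<forall>m<n. r - f m \<in> I)"
      by (intro exI[of _ x]) fastforce
  qed simp
  then obtain f where f: "\<And>n. f n \<in> B n" and fI: "\<And>m n. m < n \<Longrightarrow> f n - f m \<in> I"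
    by blast
  have "pairwise (\<lambda>x y. x - y \<in> I) (range f)"
  proof (rule pairwiseI)
    fix x y assume "x \<in> range f" "y \<in> range f" "x \<noteq> y"
    then obtain m n where mn: "x = f m" "y = f n" "m \<noteq> n" by blast
    then show "x - y \<in> I"
      using fI[of m n] fI[of n m] sym[of "f n - f m"] by (cases "m < n") auto
  qed
  have "dense (range f)"
    unfolding dense_iff_meets_open
  proof (intro allI impI)
    fix W :: "'a set" assume "open W" "W \<noteq> {}"
    then obtain w e where we: "w \<in> W" "e > 0" "ball w e \<subseteq> W"
      by (metis ex_in_conv open_contains_ball)
    obtain k where k: "inverse (real (Suc k)) < e / 2"
      using reals_Archimedean[of "e / 2"] we(2) by auto
    obtain i where i: "dist w (c i) < e / 2"
      using dense_meets_open[OF c, of "ball w (e/2)" w] we(2) by auto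
    have "dist (c i) (f (prod_encode (i, k))) < inverse (real (Suc k))"
      using f[of "prod_encode (i, k)"] by (simp add: B_def)
    then have "dist w (f (prod_encode (i, k))) < e"
      using dist_triangle[of w "f (prod_encode (i, k))" "c i"] i k by linarith
    then have "f (prod_encode (i, k)) \<in> W"
      using we(3) by auto
    then show "W \<inter> range f \<noteq> {}"
      by blast
  qed
  define A where "A = {K. range f \<subseteq> K \<and> pairwise (\<lambda>x y. x - y \<in> I) K}"
  have "\<exists>M\<in>A. \<forall>X\<in>A. M \<subseteq> X \<longrightarrow> X = M"
  proof (rule subset_Zorn_nonempty)
    show "A \<noteq> {}"
      using \<open>pairwise (\<lambda>x y. x - y \<in> I) (range f)\<close> by (auto simp: A_def)
    fix \<C> assume \<C>: "\<C> \<noteq> {}" "subset.chain A \<C>"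
    then have "chain\<^sub>\<subseteq> \<C>"
      unfolding subset.chain_def chain_subset_def by blast
    then have "pairwise (\<lambda>x y. x - y \<in> I) (\<Union>\<C>)"
      using \<C>(2) by (intro pairwise_chain_Union) (auto simp: A_def subset.chain_def)
    moreover have "range f \<subseteq> \<Union>\<C>"
      using \<C> unfolding A_def subset.chain_def by blast
    ultimately show "\<Union>\<C> \<in> A"
      by (simp add: A_def)
  qed
  then obtain M where M: "M \<in> A" and max: "\<And>X. X \<in> A \<Longrightarrow> M \<subseteq> X \<Longrightarrow> X = M"
    by blast
  have "uncountable M"
  proof
    assume "countable M"
    \<comment> \<open>A countable \<open>M\<close> could be extended by \<open>x\<close>, so
      maximality would put \<open>x\<close> in \<open>M\<close> and \<open>x - x = 0\<close> in
      \<open>I\<close>.\<close>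
    then obtain x where x: "x \<in> (\<Inter>a\<in>M. (+) a ` I)"
      using dense_meets_open[OF dense_INT_translations[OF I(1,2)], of M UNIV] by blast
    then have xI: "x - a \<in> I" if "a \<in> M" for a
      using that by fastforce
    then have "a - x \<in> I" if "a \<in> M" for a
      using sym[OF xI] that by simp
    then have "insert x M \<in> A"
      using M xI unfolding A_def by (auto simp: pairwise_insert)
    then have "x \<in> M"
      using max by blast
    then show False
      using xI[of x] I(3) by simp
  qed
  moreover have "dense M" "pairwise (\<lambda>x y. x - y \<in> I) M"
    using M dense_mono[OF \<open>dense (range f)\<close>] by (auto simp: A_def)
  ultimately show ?thesis by blast
qed

section \<open>Lower and upper limits of real sequences\<close>

text \<open>One natural number \<open>k\<close> serves both as lower bound for the index and as
  tolerance, which makes the condition a countable intersection suited to G_delta arguments.\<close>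

lemma liminf_nonneg_eq_0_iff:
  fixes a :: "nat \<Rightarrow> real"
  assumes "\<And>n. 0 \<le> a n"
  shows "liminf (\<lambda>n. ereal (a n)) = 0 \<longleftrightarrow> (\<forall>k. \<exists>n\<ge>k. a n < inverse (real (Suc k)))"
proof
  assume L: "liminf (\<lambda>n. ereal (a n)) = 0"
  show "\<forall>k. \<exists>n\<ge>k. a n < inverse (real (Suc k))"
  proof (rule ccontr)
    assume "\<not> ?thesis"
    then obtain k where "\<And>n. n \<ge> k \<Longrightarrow> inverse (real (Suc k)) \<le> a n"
      by (meson not_less)
    then have "ereal (inverse (real (Suc k))) \<le> liminf (\<lambda>n. ereal (a n))"
      by (intro Liminf_bounded) (auto simp: eventually_sequentially)
    moreover have "0 < inverse (real (Suc k))" by simp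
    ultimately show False
      using L by simp
  qed
next
  assume small: "\<forall>k. \<exists>n\<ge>k. a n < inverse (real (Suc k))"
  have "0 \<le> liminf (\<lambda>n. ereal (a n))"
    using assms by (intro Liminf_bounded) auto
  moreover have "\<not> 0 < liminf (\<lambda>n. ereal (a n))"
  proof
    assume "0 < liminf (\<lambda>n. ereal (a n))"
    then obtain c where c: "0 < c" "ereal c < liminf (\<lambda>n. ereal (a n))"
      using ereal_dense2[of 0] by (metis ereal_less(2))
    obtain N where N: "\<And>n. n \<ge> N \<Longrightarrow> c < a n"
      using less_LiminfD[OF c(2)] by (auto simp: eventually_sequentially)
    obtain j where j: "inverse (real (Suc j)) < c"
      using reals_Archimedean[OF c(1)] by auto
    \<comment> \<open>The choice \<open>max N j\<close> puts the index beyond \<open>N\<close> and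
      the tolerance below \<open>c\<close> at the same time.\<close>
    obtain n where n: "n \<ge> max N j" "a n < inverse (real (Suc (max N j)))"
      using small by blast
    have "inverse (real (Suc (max N j))) \<le> inverse (real (Suc j))"
      by (intro le_imp_inverse_le) auto
    then show False
      using N[of n] n by (smt (verit) j max.bounded_iff)
  qed
  ultimately show "liminf (\<lambda>n. ereal (a n)) = 0" by simp
qed

text \<open>The index on the right needs no lower bound: an upper bound for a tail extends to the
  whole sequence, because only finitely many terms come before the tail.\<close>

lemma limsup_eq_PInf_iff:
  fixes a :: "nat \<Rightarrow> real"
  shows "limsup (\<lambda>n. ereal (a n)) = \<infinity> \<longleftrightarrow> (\<forall>k. \<exists>n. real k < a n)"
proof
  assume L: "limsup (\<lambda>n. ereal (a n)) = \<infinity>"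
  show "\<forall>k. \<exists>n. real k < a n"
  proof (rule ccontr)
    assume "\<not> ?thesis"
    then obtain k where "\<And>n. a n \<le> real k"
      by (meson not_less)
    then have "limsup (\<lambda>n. ereal (a n)) \<le> ereal (real k)"
      by (intro Limsup_bounded) auto
    then show False
      using L by simp
  qed
next
  assume large: "\<forall>k. \<exists>n. real k < a n"
  show "limsup (\<lambda>n. ereal (a n)) = \<infinity>"
  proof (rule ccontr)
    assume "\<not> ?thesis"
    then obtain b where "limsup (\<lambda>n. ereal (a n)) < ereal b"
      using ereal_dense2[of _ \<infinity>] by auto
    then obtain N where N: "\<And>n. n \<ge> N \<Longrightarrow> a n < b"
      using Limsup_lessD by (fastforce simp: eventually_sequentially)
    \<comment> \<open>The maximum over the first \<open>N\<close> terms bounds the initial segment;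
      \<open>b\<close> bounds the tail and keeps the set nonempty when \<open>N = 0\<close>.\<close>
    define m where "m = Max (insert b (a ` {..<N}))"
    have "a n \<le> m" for n
    proof (cases "n < N")
      case True
      then show ?thesis unfolding m_def by (intro Max_ge) auto
    next
      case False
      then have "a n \<le> b" using N[of n] by simp
      also have "b \<le> m" unfolding m_def by (intro Max_ge) auto
      finally show ?thesis .
    qed
    moreover obtain k where "m \<le> real k"
      using real_arch_simple by blast
    ultimately show False
      using large by (meson not_less order_trans)
  qed
qed

section \<open>The mean seminorms of a sequence of operators\<close>

text \<open>The real-valued form of \<open>mean_norm\<close> as a function of the vector, for which
  homogeneity, subadditivity and continuity can be stated. At \<open>n = 0\<close> it is 0.\<close>

definition mean_seminorm ::
    "(nat \<Rightarrow> 'a::real_normed_vector \<Rightarrow> 'b::real_normed_vector) \<Rightarrow> nat \<Rightarrow> 'a \<Rightarrow> real" where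
  "mean_seminorm T n x = 1 / real n * (\<Sum>i=1..n. norm (T i x))"

lemma mean_norm_eq_mean_seminorm:
  "mean_norm (\<lambda>i. T i x) = (\<lambda>n. ereal (mean_seminorm T n x))"
  by (simp add: mean_norm_def mean_seminorm_def fun_eq_iff)

lemma mean_seminorm_nonneg: "0 \<le> mean_seminorm T n x"
  by (simp add: mean_seminorm_def sum_nonneg)

lemma absolutely_mean_irregular_iff:
  "absolutely_mean_irregular T x \<longleftrightarrow>
     (\<forall>k. \<exists>n\<ge>k. mean_seminorm T n x < inverse (real (Suc k))) \<and>
     (\<forall>k. \<exists>n. real k < mean_seminorm T n x)"
  unfolding absolutely_mean_irregular_def mean_norm_eq_mean_seminorm
  by (simp add: liminf_nonneg_eq_0_iff mean_seminorm_nonneg limsup_eq_PInf_iff)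

locale operator_sequence =
  fixes T :: "nat \<Rightarrow> 'a::real_normed_vector \<Rightarrow> 'b::real_normed_vector"
  assumes bounded_linear: "\<And>i. i \<ge> 1 \<Longrightarrow> bounded_linear (T i)"
begin

lemma linear: "i \<ge> 1 \<Longrightarrow> linear (T i)"
  using bounded_linear bounded_linear.linear by blast

lemma mean_norm_diff: "mean_norm (\<lambda>i. T i x - T i y) = mean_norm (\<lambda>i. T i (x - y))"
  by (simp add: mean_norm_def fun_eq_iff linear linear_diff)

lemma mean_seminorm_scaleR: "mean_seminorm T n (r *\<^sub>R x) = \<bar>r\<bar> * mean_seminorm T n x"
  by (simp add: mean_seminorm_def linear linear_scale sum_distrib_left mult_ac)

lemma mean_seminorm_add: "mean_seminorm T n (x + y) \<le> mean_seminorm T n x + mean_seminorm T n y"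
proof -
  have "(\<Sum>i=1..n. norm (T i (x + y))) \<le> (\<Sum>i=1..n. norm (T i x) + norm (T i y))"
    by (intro sum_mono) (simp add: linear linear_add norm_triangle_ineq)
  then show ?thesis
    unfolding mean_seminorm_def
    by (simp add: sum.distrib add_divide_distrib[symmetric] divide_right_mono)
qed

lemma mean_seminorm_minus: "mean_seminorm T n (- x) = mean_seminorm T n x"
  using mean_seminorm_scaleR[of n "-1" x] by simp

lemma mean_seminorm_0: "mean_seminorm T n 0 = 0"
  using mean_seminorm_scaleR[of n 0 0] by simp

lemma continuous_on_mean_seminorm: "continuous_on S (mean_seminorm T n)"
  unfolding mean_seminorm_def
  by (intro continuous_intros linear_continuous_on bounded_linear) auto

lemma mean_proximal_iff:
  "mean_proximal T x y \<longleftrightarrow> (\<forall>k. \<exists>n\<ge>k. mean_seminorm T n (x - y) < inverse (real (Suc k)))"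
  unfolding mean_proximal_def mean_norm_diff mean_norm_eq_mean_seminorm
  by (simp add: liminf_nonneg_eq_0_iff mean_seminorm_nonneg)

lemma mean_proximal_refl: "mean_proximal T x x"
  by (auto simp: mean_proximal_iff mean_seminorm_0)

lemma mean_LY_extreme_pair_iff:
  "mean_LY_extreme_pair T x y \<longleftrightarrow> absolutely_mean_irregular T (x - y)"
  unfolding mean_LY_extreme_pair_def mean_proximal_def absolutely_mean_irregular_def
    mean_norm_diff ..

lemma extreme_pairs_eq_vimage:
  "{(x, y). mean_LY_extreme_pair T x y} = (\<lambda>(x, y). x - y) -` {x. absolutely_mean_irregular T x}"
  by (auto simp: mean_LY_extreme_pair_iff)

section \<open>Irregular vectors and extreme pairs as G_delta sets\<close>

lemma open_small_mean: "open {x. \<exists>n\<ge>k. mean_seminorm T n x < r}"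
proof -
  have "open (\<Union>n\<in>{k..}. {x. mean_seminorm T n x < r})"
    by (intro open_UN ballI open_Collect_less continuous_on_mean_seminorm continuous_intros)
  also have "(\<Union>n\<in>{k..}. {x. mean_seminorm T n x < r}) = {x. \<exists>n\<ge>k. mean_seminorm T n x < r}"
    by auto
  finally show ?thesis .
qed

lemma open_large_mean: "open {x. \<exists>n. r < mean_seminorm T n x}"
  by (intro open_Collect_ex open_Collect_less continuous_on_mean_seminorm continuous_intros)

lemma gdelta_absolutely_mean_irregular: "gdelta {x. absolutely_mean_irregular T x}"
proof -
  have "gdelta (\<Inter>k. {x. \<exists>n\<ge>k. mean_seminorm T n x < inverse (real (Suc k))} \<inter>
                    {x. \<exists>n. real k < mean_seminorm T n x})"
    by (intro gdelta.intros open_Int open_small_mean open_large_mean)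
  also have "(\<Inter>k. {x. \<exists>n\<ge>k. mean_seminorm T n x < inverse (real (Suc k))} \<inter>
                    {x. \<exists>n. real k < mean_seminorm T n x}) = {x. absolutely_mean_irregular T x}"
    by (auto simp: absolutely_mean_irregular_iff)
  finally show ?thesis .
qed

lemma gdelta_extreme_pairs: "gdelta {(x, y). mean_LY_extreme_pair T x y}"
  unfolding extreme_pairs_eq_vimage
  by (intro gdelta_vimage gdelta_absolutely_mean_irregular)
    (auto simp: case_prod_unfold intro!: continuous_intros)

lemma dense_extreme_pairs_iff:
  "dense {(x, y). mean_LY_extreme_pair T x y} \<longleftrightarrow> dense {x. absolutely_mean_irregular T x}"
  unfolding extreme_pairs_eq_vimage by (rule dense_differences_iff)

section \<open>Consequences of dense chaos\<close>

lemma limsup_mean_norm_diff_triangle: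
  "limsup (mean_norm (\<lambda>i. T i y - T i z)) \<le>
     limsup (mean_norm (\<lambda>i. T i x - T i y)) + limsup (mean_norm (\<lambda>i. T i x - T i z))"
proof -
  have "mean_seminorm T n (y - z) \<le> mean_seminorm T n (x - y) + mean_seminorm T n (x - z)" for n
    \<comment> \<open>The difference \<open>y - z\<close> is split as
      \<open>(y - x) + (x - z)\<close>.\<close>
    using mean_seminorm_add[of n "y - x" "x - z"] mean_seminorm_minus[of n "x - y"] by simp
  then have "limsup (\<lambda>n. ereal (mean_seminorm T n (y - z))) \<le>
      limsup (\<lambda>n. ereal (mean_seminorm T n (x - y)) + ereal (mean_seminorm T n (x - z)))"
    by (intro Limsup_mono) auto
  also have "\<dots> \<le> limsup (\<lambda>n. ereal (mean_seminorm T n (x - y))) +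
      limsup (\<lambda>n. ereal (mean_seminorm T n (x - z)))"
    by (rule ereal_limsup_add_mono)
  finally show ?thesis
    unfolding mean_norm_diff mean_norm_eq_mean_seminorm .
qed

text \<open>The square of a dense scrambled set is dense in the product. Its off-diagonal pairs are
  proximal by scrambledness, its diagonal pairs trivially.\<close>

lemma chaotic_imp_dense_mean_proximal:
  assumes "densely_mean_LY_chaotic T \<delta>"
  shows "dense (mean_proximal_relation T)"
proof -
  obtain K where K: "dense K" "mean_LY_scrambled T \<delta> K"
    using assms unfolding densely_mean_LY_chaotic_def by blast
  have "dense (K \<times> K)"
    using K(1) by (simp add: dense_def closure_Times)
  moreover have "mean_proximal T x y" if "x \<in> K" "y \<in> K" for x y
    using K(2) that mean_proximal_refl
    by (cases "x = y") (auto simp: mean_LY_scrambled_def mean_LY_pair_def pairwise_def)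
  then have "K \<times> K \<subseteq> mean_proximal_relation T"
    by (auto simp: mean_proximal_relation_def)
  ultimately show ?thesis
    by (rule dense_mono)
qed

text \<open>Near any \<open>x\<close> lie two distinct points \<open>y\<close>, \<open>z\<close> of
  the scrambled set. Their upper limit is at least \<open>\<delta>\<close>, so by the triangle
  inequality at least one of them has upper limit above \<open>\<delta> / 3\<close> relative to
  \<open>x\<close>.\<close>

lemma chaotic_imp_mean_sensitive:
  assumes "densely_mean_LY_chaotic T \<delta>" "\<delta> > 0"
  shows "mean_sensitive T"
proof -
  obtain K where K: "dense K" "uncountable K" "mean_LY_scrambled T \<delta> K"
    using assms unfolding densely_mean_LY_chaotic_def by blast
  \<comment> \<open>A nonzero vector, available because \<open>K\<close> is uncountable, guarantees
    that a ball contains more than one point.\<close>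
  obtain v :: 'a where "v \<noteq> 0"
  proof -
    have "\<not> K \<subseteq> {0}"
      using K(2) countable_subset[of K "{0}"] by auto
    then show ?thesis using that by blast
  qed
  have "\<exists>y. norm (x - y) < \<epsilon> \<and> limsup (mean_norm (\<lambda>i. T i x - T i y)) > ereal (\<delta> / 3)"
    if \<epsilon>: "\<epsilon> > 0" for x \<epsilon>
  proof -
    obtain y where y: "y \<in> K" "y \<in> ball x \<epsilon>"
      using dense_meets_open[OF K(1), of "ball x \<epsilon>" x] \<epsilon> by auto
    \<comment> \<open>\<open>w\<close> shows that the ball without \<open>y\<close> is nonempty: it
      is \<open>x\<close> itself, or \<open>x\<close> moved by a vector of norm
      \<open>\<epsilon> / 2\<close> when \<open>y = x\<close>.\<close>
    define w where "w = (if y = x then x + (\<epsilon> / (2 * norm v)) *\<^sub>R v else x)"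
    have "w \<in> ball x \<epsilon> - {y}"
      using \<open>v \<noteq> 0\<close> \<epsilon> by (auto simp: w_def dist_norm)
    then obtain z where z: "z \<in> K" "z \<in> ball x \<epsilon> - {y}"
      using dense_meets_open[OF K(1), of "ball x \<epsilon> - {y}" w] by (auto simp: open_Diff)
    have "ereal \<delta> \<le> limsup (mean_norm (\<lambda>i. T i y - T i z))"
      using K(3) y z by (auto simp: mean_LY_scrambled_def pairwise_def mean_LY_pair_def)
    also note limsup_mean_norm_diff_triangle[of y z x]
    finally have sum: "ereal \<delta> \<le> limsup (mean_norm (\<lambda>i. T i x - T i y)) +
        limsup (mean_norm (\<lambda>i. T i x - T i z))" .
    have "ereal (\<delta> / 3) < limsup (mean_norm (\<lambda>i. T i x - T i y)) \<or>
        ereal (\<delta> / 3) < limsup (mean_norm (\<lambda>i. T i x - T i z))"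
    proof (rule ccontr)
      assume "\<not> ?thesis"
      then have "limsup (mean_norm (\<lambda>i. T i x - T i y)) + limsup (mean_norm (\<lambda>i. T i x - T i z))
          \<le> ereal (\<delta> / 3) + ereal (\<delta> / 3)"
        by (intro add_mono) auto
      with sum have "ereal \<delta> \<le> ereal (\<delta> / 3) + ereal (\<delta> / 3)"
        by (rule order_trans)
      then show False
        using assms(2) by simp
    qed
    then show ?thesis
      using y z by (auto simp: dist_norm)
  qed
  then show ?thesis
    unfolding mean_sensitive_def using assms(2)
    by (intro exI[of _ "\<delta> / 3"]) auto
qed

text \<open>Homogeneity amplifies sensitivity: a difference with some mean above
  \<open>\<delta>\<close> can be chosen so small that, after scaling its means beyond
  \<open>r\<close>, its norm is still below the radius allowed around \<open>w\<close>.\<close>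

lemma mean_sensitive_imp_dense_large_mean:
  assumes "mean_sensitive T"
  shows "dense {x. \<exists>n. r < mean_seminorm T n x}"
  unfolding dense_iff_meets_open
proof (intro allI impI)
  fix W :: "'a set" assume "open W" "W \<noteq> {}"
  then obtain w e where we: "w \<in> W" "e > 0" "ball w e \<subseteq> W"
    by (metis ex_in_conv open_contains_ball)
  obtain \<delta> where "\<delta> > 0" and \<delta>: "\<And>x \<epsilon>. \<epsilon> > 0 \<Longrightarrow> \<exists>y. norm (x - y) < \<epsilon> \<and>
      limsup (mean_norm (\<lambda>i. T i x - T i y)) > ereal \<delta>"
    using assms unfolding mean_sensitive_def by blast
  \<comment> \<open>Chosen so that \<open>t * \<delta> = \<bar>r\<bar> + 1\<close> exceeds
    \<open>r\<close>; the radius \<open>e / t\<close> below compensates for the scaling.\<close>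
  define t where "t = (\<bar>r\<bar> + 1) / \<delta>"
  have "t > 0"
    using \<open>\<delta> > 0\<close> by (auto simp: t_def)
  then obtain u where u: "norm (w - u) < e / t"
      "limsup (mean_norm (\<lambda>i. T i w - T i u)) > ereal \<delta>"
    using \<delta>[of "e / t"] we(2) by auto
  have "\<exists>n. \<delta> < mean_seminorm T n (w - u)"
  proof (rule ccontr)
    assume "\<not> ?thesis"
    then have "limsup (\<lambda>n. ereal (mean_seminorm T n (w - u))) \<le> ereal \<delta>"
      by (intro Limsup_bounded) (auto simp: not_less)
    then show False
      using u(2) unfolding mean_norm_diff mean_norm_eq_mean_seminorm by simp
  qed
  then obtain n where n: "\<delta> < mean_seminorm T n (w - u)" ..
  define y where "y = t *\<^sub>R (w - u)"
  have "norm y < e"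
    using u(1) \<open>t > 0\<close> by (simp add: y_def pos_less_divide_eq mult.commute)
  then have ball: "w + y \<in> W" "w - y \<in> W"
    using we(3) by (auto simp: dist_norm subset_iff)
  have "r < t * \<delta>"
    using \<open>\<delta> > 0\<close> by (simp add: t_def)
  also have "t * \<delta> < mean_seminorm T n y"
    using n \<open>t > 0\<close> by (simp add: y_def mean_seminorm_scaleR)
  finally have "r < mean_seminorm T n y" .
  \<comment> \<open>Since \<open>2 y = (w + y) - (w - y)\<close>, the means at \<open>w + y\<close>
    and \<open>w - y\<close> cannot both be at most \<open>r\<close>.\<close>
  moreover have "2 * mean_seminorm T n y \<le> mean_seminorm T n (w + y) + mean_seminorm T n (w - y)"
  proof -
    have "2 *\<^sub>R y = (w + y) + (- (w - y))"
      by (simp add: scaleR_2)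
    then have "mean_seminorm T n (2 *\<^sub>R y) \<le> mean_seminorm T n (w + y) + mean_seminorm T n (w - y)"
      using mean_seminorm_add[of n "w + y" "- (w - y)"] mean_seminorm_minus[of n "w - y"] by simp
    then show ?thesis
      by (simp add: mean_seminorm_scaleR)
  qed
  ultimately have "r < mean_seminorm T n (w + y) \<or> r < mean_seminorm T n (w - y)"
    by linarith
  then show "W \<inter> {x. \<exists>n. r < mean_seminorm T n x} \<noteq> {}"
    using ball by blast
qed

text \<open>The relation lies in the preimage of this set under subtraction, so
  \<open>dense_differences_iff\<close> applies.\<close>

lemma dense_mean_proximal_imp_dense_small_mean:
  assumes "dense (mean_proximal_relation T)"
  shows "dense {x. \<exists>n\<ge>k. mean_seminorm T n x < inverse (real (Suc k))}"
proof -
  have "mean_proximal_relation T \<subseteq>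
      (\<lambda>(x, y). x - y) -` {x. \<exists>n\<ge>k. mean_seminorm T n x < inverse (real (Suc k))}"
    by (auto simp: mean_proximal_relation_def mean_proximal_iff)
  then show ?thesis
    using dense_mono[OF assms] dense_differences_iff by blast
qed

lemma extremely_chaotic_imp_chaotic:
  "densely_mean_LY_extremely_chaotic T \<Longrightarrow> densely_mean_LY_chaotic T \<delta>"
  unfolding densely_mean_LY_extremely_chaotic_def densely_mean_LY_chaotic_def
    mean_LY_extremely_scrambled_def mean_LY_scrambled_def
  by (auto simp: mean_LY_extreme_pair_def mean_LY_pair_def pairwise_def)

end

section \<open>Baire category arguments on a Banach space\<close>

locale banach_operator_sequence = operator_sequence T
  for T :: "nat \<Rightarrow> 'a::banach \<Rightarrow> 'b::real_normed_vector"
begin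

lemma dense_absolutely_mean_irregular:
  assumes "dense (mean_proximal_relation T)" "mean_sensitive T"
  shows "dense {x. absolutely_mean_irregular T x}"
proof -
  \<comment> \<open>The boolean merges the small-mean and the large-mean conditions into one
    countable family, so that Baire is applied once.\<close>
  define F where "F p = (if fst p
      then {x. \<exists>n\<ge>snd p. mean_seminorm T n x < inverse (real (Suc (snd p)))}
      else {x. \<exists>n. real (snd p) < mean_seminorm T n x})" for p :: "bool \<times> nat"
  have "dense (\<Inter>p\<in>UNIV. F p)"
    using assms
    by (intro dense_INT_of_open_dense)
      (auto simp: F_def open_small_mean open_large_mean
        mean_sensitive_imp_dense_large_mean dense_mean_proximal_imp_dense_small_mean
        simp del: of_nat_Suc)
  moreover have "absolutely_mean_irregular T x" if "x \<in> (\<Inter>p\<in>UNIV. F p)" for x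
  proof -
    have "x \<in> F (True, k)" "x \<in> F (False, k)" for k
      using that by blast+
    then show ?thesis
      unfolding F_def absolutely_mean_irregular_iff fst_conv snd_conv by simp
  qed
  ultimately show ?thesis
    by (elim dense_mono) blast
qed

text \<open>The irregular vectors form a G_delta set that is symmetric, as the means are even, and
  omits 0, where all means vanish. They can therefore serve as the set of admissible
  differences.\<close>

lemma dense_irregular_imp_extremely_chaotic:
  assumes "separable_space (euclidean :: 'a topology)" "dense {x. absolutely_mean_irregular T x}"
  shows "densely_mean_LY_extremely_chaotic T"
proof -
  have "\<exists>K. dense K \<and> uncountable K \<and>
      pairwise (\<lambda>x y. x - y \<in> {x. absolutely_mean_irregular T x}) K"
    using assms gdelta_absolutely_mean_irregular
    by (intro exists_dense_uncountable_pairwise)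
      (auto simp: absolutely_mean_irregular_iff mean_seminorm_0 mean_seminorm_minus)
  then show ?thesis
    by (simp add: densely_mean_LY_extremely_chaotic_def mean_LY_extremely_scrambled_def
        mean_LY_extreme_pair_iff[abs_def])
qed

end

theorem theorem3p9:
  fixes T :: "nat \<Rightarrow> 'a::banach \<Rightarrow> 'b::real_normed_vector"
  assumes "separable_space (euclidean :: 'a topology)"
    and "\<And>i. i \<ge> 1 \<Longrightarrow> bounded_linear (T i)"
  shows "((\<exists>\<delta>>0. densely_mean_LY_chaotic T \<delta>)
           \<longleftrightarrow> densely_mean_LY_extremely_chaotic T)
       \<and> (densely_mean_LY_extremely_chaotic T
           \<longleftrightarrow> dense {(x, y). mean_LY_extreme_pair T x y})
       \<and> (dense {(x, y). mean_LY_extreme_pair T x y}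
           \<longleftrightarrow> residual {(x, y). mean_LY_extreme_pair T x y})
       \<and> (residual {(x, y). mean_LY_extreme_pair T x y}
           \<longleftrightarrow> dense {x. absolutely_mean_irregular T x})
       \<and> (dense {x. absolutely_mean_irregular T x}
           \<longleftrightarrow> residual {x. absolutely_mean_irregular T x})
       \<and> (residual {x. absolutely_mean_irregular T x}
           \<longleftrightarrow> dense (mean_proximal_relation T) \<and> mean_sensitive T)"
proof -
  interpret banach_operator_sequence T
    by (intro banach_operator_sequence.intro operator_sequence.intro assms(2))
  note extremely_chaotic = dense_irregular_imp_extremely_chaotic[OF assms(1)]
  have chaotic: "dense (mean_proximal_relation T) \<and> mean_sensitive T"
    if "\<exists>\<delta>>0. densely_mean_LY_chaotic T \<delta>"
    using that chaotic_imp_dense_mean_proximal chaotic_imp_mean_sensitive by blast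
  have irregular: "dense {x. absolutely_mean_irregular T x}"
    if "dense (mean_proximal_relation T) \<and> mean_sensitive T"
    using that dense_absolutely_mean_irregular by blast
  have weaken: "\<exists>\<delta>>0. densely_mean_LY_chaotic T \<delta>" if "densely_mean_LY_extremely_chaotic T"
    using extremely_chaotic_imp_chaotic[OF that] zero_less_one by blast
  have pairs: "residual {(x, y). mean_LY_extreme_pair T x y} \<longleftrightarrow>
      dense {(x, y). mean_LY_extreme_pair T x y}"
    using residual_imp_dense gdelta_dense_imp_residual[OF gdelta_extreme_pairs] by blast
  have vectors: "residual {x. absolutely_mean_irregular T x} \<longleftrightarrow>
      dense {x. absolutely_mean_irregular T x}"
    using residual_imp_dense gdelta_dense_imp_residual[OF gdelta_absolutely_mean_irregular] by blast
  \<comment> \<open>Rewriting turns every statement about extreme pairs or residual sets into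
    density of the irregular vectors. What remains is a cycle: chaos gives proximal density with
    sensitivity, these give dense irregular vectors, these give extreme chaos, and that gives
    chaos.\<close>
  show ?thesis
    unfolding pairs vectors dense_extreme_pairs_iff
    using extremely_chaotic chaotic irregular weaken by blast
qed

end
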